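(* Statement (D) below implies statement (P) below. (D) For all integers $n\ge 1$ and $k\ge 1$, for every map $f$ from $\{1,2,\ldots,n\}$ to the set of subsets of $\{1,2,\ldots,n\}$ such that $\bigcup_{i=1}^n f(i)=\{1,2,\ldots,n\}$, and for every partition of $\{1,\ldots,n\}$ into $k$ nonempty blocks of consecutive integers $$I_1=\{1,2,\ldots,i_1\},\quad I_2=\{i_1+1,\ldots,i_2\},\quad\ldots,\quad I_k=\{i_{k-1}+1,\ldots,n\},$$ there exist $j\in\{1,\ldots,k\}$, elements $r,s\in I_j$ (possibly equal), and an integer $l$ with $1\le l\le k$ such that $(\mathrm{conv}f)^l(\{r,s\})\supseteq\{r,s\}$. (P) For every integer $k\ge 1$, every continuous map $f:\mathbb{R}\to\mathbb{R}$ and all closed bounded intervals $I_1,\ldots,I_k\subset\mathbb{R}$ with $f(I_1\cup\cdots\cup I_k)\supseteq I_1\cup\cdots\cup I_k$, there exist a point $x_0\in I_1\cup\cdots\cup I_k$ and an integer $l$ with $1\le l\le k$ such that $f^l(x_0)=x_0$.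
   Context: In (D), for a set $A\subseteq\{1,\ldots,n\}$ write $f(A)=\bigcup_{a\in A}f(a)$ and let $\mathrm{conv}f(A)=\{\min f(A),\min f(A)+1,\ldots,\max f(A)\}$ be the convex hull of $f(A)$ in the integers (with $\mathrm{conv}f(A)=\emptyset$ if $f(A)=\emptyset$); $(\mathrm{conv}f)^l$ is the $l$-fold iterate of the set map $A\mapsto\mathrm{conv}f(A)$. In (P), $f^l$ denotes the $l$-th iterate of $f$. Both (D) and (P) are conjectures; the result is only the implication between them. *)

theory Defs
  imports Complex_Main
begin

definition conv_image :: "(nat \<Rightarrow> nat set) \<Rightarrow> nat set \<Rightarrow> nat set" where
  "conv_image f A =
     (let B = (\<Union>a\<in>A. f a) in if B = {} then {} else {Min B..Max B})"

(* Block boundaries 0 = e 0 < e 1 < ... < e k = n; for j in {1..k} the j-th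
   block is {e (j - 1) + 1..e j}. *)
definition block_ends :: "nat \<Rightarrow> nat \<Rightarrow> (nat \<Rightarrow> nat) \<Rightarrow> bool" where
  "block_ends n k e \<longleftrightarrow> e 0 = 0 \<and> e k = n \<and> (\<forall>j<k. e j < e (Suc j))"

definition block :: "(nat \<Rightarrow> nat) \<Rightarrow> nat \<Rightarrow> nat set" where
  "block e j = {e (j - 1) + 1..e j}"

(* Values of f outside {1..n} are irrelevant: all iterates of conv_image f
   starting from a subset of {1..n} stay inside {1..n}. *)
definition statement_D :: bool where
  "statement_D \<longleftrightarrow>
     (\<forall>(n::nat) (k::nat) (f :: nat \<Rightarrow> nat set) (e :: nat \<Rightarrow> nat).
        n \<ge> 1 \<longrightarrow> k \<ge> 1 \<longrightarrow>
        (\<forall>i\<in>{1..n}. f i \<subseteq> {1..n}) \<longrightarrow>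
        (\<Union>i\<in>{1..n}. f i) = {1..n} \<longrightarrow>
        block_ends n k e \<longrightarrow>
        (\<exists>j\<in>{1..k}. \<exists>r\<in>block e j. \<exists>s\<in>block e j. \<exists>l\<in>{1..k}.
           (conv_image f ^^ l) {r, s} \<supseteq> {r, s}))"

(* The intervals are nonempty; they may overlap or degenerate to points. *)
definition statement_P :: bool where
  "statement_P \<longleftrightarrow>
     (\<forall>(k::nat) (f :: real \<Rightarrow> real) (a :: nat \<Rightarrow> real) (b :: nat \<Rightarrow> real).
        k \<ge> 1 \<longrightarrow>
        continuous_on UNIV f \<longrightarrow>
        (\<forall>j\<in>{1..k}. a j \<le> b j) \<longrightarrow>
        f ` (\<Union>j\<in>{1..k}. {a j..b j}) \<supseteq> (\<Union>j\<in>{1..k}. {a j..b j}) \<longrightarrow>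
        (\<exists>x0\<in>(\<Union>j\<in>{1..k}. {a j..b j}). \<exists>l\<in>{1..k}. (f ^^ l) x0 = x0))"

end

theory Submission imports Defs "HOL-Analysis.Analysis" begin

text \<open>
  Let \<open>U\<close> be the union of the intervals and suppose that none of \<open>f, \<dots>, f\<^sup>k\<close> has a fixed point in
  \<open>U\<close>. By compactness each displacement \<open>\<bar>f\<^sup>l x - x\<bar>\<close> with \<open>1 \<le> l \<le> k\<close> is bounded below on \<open>U\<close> by a
  positive constant. This margin is enough to replace \<open>f\<close> by a set-valued map on a finite set:
  take a fine finite net \<open>p 1 < \<dots> < p n\<close> in \<open>U\<close> and let \<open>F a\<close> consist of all \<open>b\<close> for which \<open>p b\<close> lies
  within \<open>\<delta>\<close> of \<open>f (p a)\<close>. Since \<open>f\<close> maps \<open>U\<close> onto a superset of \<open>U\<close>, every \<open>b\<close> belongs to some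
  \<open>F a\<close> if the net is fine enough (\<open>covering_discrete_model\<close>), so (D) is applicable.

  The given intervals may overlap, so they do not cut the net into blocks directly. Instead a point
  of \<open>U\<close> is coloured by the largest right endpoint among the intervals containing it. This
  colour is monotone, takes at most \<open>k\<close> values, and two points of the same colour lie in a common
  interval (\<open>union_intervals_colouring\<close>). The colour classes on the net are therefore blocks of
  consecutive indices, and (D) gives equally coloured \<open>r\<close>, \<open>s\<close> and some \<open>l \<le> k\<close> such that the
  \<open>l\<close>-th discrete hull of \<open>{r, s}\<close> contains \<open>{r, s}\<close>
  (\<open>statement_D_monotone_colouring\<close>).

  Back on the line, let \<open>K\<close> be the segment between \<open>p r\<close> and \<open>p s\<close>, which lies in \<open>U\<close>. The image of an
  interval is an interval, so filling the gaps in the discrete model costs nothing: each point of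
  the \<open>l\<close>-th discrete hull is, up to a small error, a value of \<open>f\<^sup>l\<close> on \<open>K\<close>
  (\<open>discrete_hull_tracking\<close>). Hence \<open>f\<^sup>l\<close> comes close to both endpoints of \<open>K\<close> on \<open>K\<close>. With an error
  below the lower bound for the displacement, \<open>f\<^sup>l x - x\<close> must take both signs on \<open>K\<close>, and so it has
  a zero there, which is a contradiction (\<open>no_periodic_point_imp_no_discrete_recurrence\<close>).
\<close>

section \<open>Statement (D) for monotone colourings\<close>

lemma finite_linorder_enumeration:
  fixes M :: "'a :: linorder set"
  assumes "finite M"
  obtains h where "bij_betw h {..<card M} M" "strict_mono_on {..<card M} h"
proof
  let ?xs = "sorted_list_of_set M"
  show "bij_betw ((!) ?xs) {..<card M} M"
    using assms by (intro bij_betw_nth) auto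
  show "strict_mono_on {..<card M} ((!) ?xs)"
    using sorted_wrt_nth_less[OF strict_sorted_list_of_set]
    by (intro strict_mono_onI) simp
qed

lemma initial_segment_card:
  fixes A :: "nat set"
  assumes "A \<subseteq> {1..n}" and down: "\<And>x y. y \<in> A \<Longrightarrow> 1 \<le> x \<Longrightarrow> x \<le> y \<Longrightarrow> x \<in> A"
  shows "A = {1..card A}"
proof (cases "A = {}")
  case False
  have "finite A"
    using assms(1) finite_subset by blast
  then have "Max A \<in> A"
    using False by simp
  then have "A = {1..Max A}"
    using \<open>finite A\<close> assms(1) by (auto intro: down)
  moreover from this have "card A = Max A"
    by (metis card_atLeastAtMost diff_Suc_1)
  ultimately show ?thesis
    by simp
qed auto

text \<open>
  The level sets of a monotone colouring of \<open>{1..n}\<close> are blocks of consecutive integers, and there are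
  at most \<open>k\<close> of them. Listing the colours in increasing order as \<open>q 0 < \<dots> < q (m - 1)\<close>, the indices
  whose colour is among the first \<open>j\<close> form an initial segment, and its length is the \<open>j\<close>-th block
  boundary. Speaking of colours avoids all bookkeeping with boundaries later.
\<close>

lemma statement_D_monotone_colouring:
  fixes c :: "nat \<Rightarrow> 'c :: linorder"
  assumes D: statement_D
    and "n \<ge> 1"
    and F: "\<forall>i\<in>{1..n}. F i \<subseteq> {1..n}" "(\<Union>i\<in>{1..n}. F i) = {1..n}"
    and c: "mono_on {1..n} c" and card: "card (c ` {1..n}) \<le> k"
  shows "\<exists>r\<in>{1..n}. \<exists>s\<in>{1..n}. c r = c s \<and>
    (\<exists>l\<in>{1..k}. {r, s} \<subseteq> (conv_image F ^^ l) {r, s})"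
proof -
  define m where "m = card (c ` {1..n})"
  obtain q where q: "bij_betw q {..<m} (c ` {1..n})" "strict_mono_on {..<m} q"
    unfolding m_def by (rule finite_linorder_enumeration[of "c ` {1..n}"]) auto
  define A where "A j = {i \<in> {1..n}. c i \<in> q ` {..<j}}" for j
  define e where "e j = card (A j)" for j
  have A: "A j = {1..e j}" if "j \<le> m" for j
    unfolding e_def
  proof (rule initial_segment_card)
    show "A j \<subseteq> {1..n}"
      by (auto simp: A_def)
  next
    fix x y assume y: "y \<in> A j" and x: "1 \<le> x" "x \<le> y"
    then obtain t where t: "t < j" "c y = q t" and "y \<le> n"
      by (auto simp: A_def)
    have "c x \<in> c ` {1..n}"
      using x \<open>y \<le> n\<close> by auto
    then obtain u where u: "u < m" "c x = q u"
      using q(1) by (auto simp: bij_betw_def)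
    have "q u \<le> q t"
      using mono_onD[OF c, of x y] x \<open>y \<le> n\<close> u t by auto
    then have "u \<le> t"
      using strict_mono_onD[OF q(2), of t u] u t that by (meson leD lessThan_iff less_le_trans not_le)
    then show "x \<in> A j"
      using u t x \<open>y \<le> n\<close> by (auto simp: A_def)
  qed
  have "A m = {1..n}"
    using q(1) by (auto simp: A_def bij_betw_def)
  have "block_ends n m e"
    unfolding block_ends_def
  proof (intro conjI allI impI)
    show "e 0 = 0"
      by (simp add: e_def A_def)
    show "e m = n"
      using \<open>A m = {1..n}\<close> by (simp add: e_def)
    fix j assume "j < m"
    then obtain i where i: "i \<in> {1..n}" "c i = q j"
      using q(1) by (force simp: bij_betw_def)
    have "inj_on q {..<m}"
      using q(1) by (simp add: bij_betw_def)
    then have "i \<notin> A j"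
      using i \<open>j < m\<close> by (auto simp: A_def dest: inj_onD)
    moreover have "i \<in> A (Suc j)" "A j \<subseteq> A (Suc j)"
      using i by (auto simp: A_def)
    ultimately have "A j \<subset> A (Suc j)"
      by blast
    then show "e j < e (Suc j)"
      unfolding e_def by (rule psubset_card_mono[rotated]) (simp add: A_def)
  qed
  moreover have "m \<ge> 1"
    using \<open>n \<ge> 1\<close> by (simp add: m_def Suc_le_eq card_gt_0_iff)
  ultimately have "\<exists>j\<in>{1..m}. \<exists>r\<in>block e j. \<exists>s\<in>block e j. \<exists>l\<in>{1..m}.
      (conv_image F ^^ l) {r, s} \<supseteq> {r, s}"
    using D[unfolded statement_D_def, rule_format, of n m F e] \<open>n \<ge> 1\<close> F by simp
  then obtain j r s l where j: "j \<in> {1..m}" and rs: "r \<in> block e j" "s \<in> block e j"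
    and l: "l \<in> {1..m}" "{r, s} \<subseteq> (conv_image F ^^ l) {r, s}"
    by blast
  have *: "i \<in> {1..n} \<and> c i = q (j - 1)" if "i \<in> block e j" for i
  proof -
    have "i \<in> A j" "i \<notin> A (j - 1)"
      using that j A[of j] A[of "j - 1"] by (auto simp: block_def)
    moreover have "{..<j} = insert (j - 1) {..<j - 1}"
      using j by auto
    ultimately show ?thesis
      by (auto simp: A_def)
  qed
  have "l \<in> {1..k}"
    using l(1) card by (simp add: m_def)
  moreover have "r \<in> {1..n}" "s \<in> {1..n}" "c r = c s"
    using *[OF rs(1)] *[OF rs(2)] by auto
  ultimately show ?thesis
    using l(2) by blast
qed

section \<open>Following the discrete hulls by the iterates of the map\<close>

lemma conv_image_subset:
  assumes "\<forall>i\<in>{1..n}. F i \<subseteq> {1..n}" "A \<subseteq> {1..n}"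
  shows "conv_image F A \<subseteq> {1..n}"
proof -
  let ?B = "\<Union>a\<in>A. F a"
  have B: "?B \<subseteq> {1..n}"
    using assms by blast
  then have "finite ?B"
    using finite_subset by blast
  then have "?B \<noteq> {} \<Longrightarrow> Min ?B \<in> {1..n} \<and> Max ?B \<in> {1..n}"
    using B Min_in Max_in by blast
  then show ?thesis
    by (auto simp: conv_image_def Let_def)
qed

lemma conv_image_funpow_subset:
  assumes "\<forall>i\<in>{1..n}. F i \<subseteq> {1..n}" "A \<subseteq> {1..n}"
  shows "(conv_image F ^^ i) A \<subseteq> {1..n}"
  by (induction i) (use assms conv_image_subset[OF assms(1)] in simp_all)

text \<open>
  Iterates of a point of \<open>U\<close> may leave \<open>U\<close>, so only one of the two compared points can be required to lie
  in \<open>U\<close>. Capping \<open>\<delta>\<close> at \<open>1\<close> keeps the other one in a fixed larger compact interval.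
\<close>

lemma uniform_continuity_near_compact:
  fixes f :: "real \<Rightarrow> real"
  assumes f: "continuous_on UNIV f" and U: "compact U" and "\<epsilon> > 0"
  shows "\<exists>\<delta>>0. \<forall>x\<in>U. \<forall>y. \<bar>y - x\<bar> < \<delta> \<longrightarrow> \<bar>f y - f x\<bar> < \<epsilon>"
proof -
  obtain M where M: "\<And>x. x \<in> U \<Longrightarrow> \<bar>x\<bar> \<le> M"
    using compact_imp_bounded[OF U] by (auto simp: bounded_iff)
  have "uniformly_continuous_on {-M-1..M+1} f"
    using f continuous_on_subset by (intro compact_uniformly_continuous) auto
  then obtain d where d: "d > 0"
    "\<And>x y. x \<in> {-M-1..M+1} \<Longrightarrow> y \<in> {-M-1..M+1} \<Longrightarrow> \<bar>y - x\<bar> < d \<Longrightarrow> \<bar>f y - f x\<bar> < \<epsilon>"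
    using \<open>\<epsilon> > 0\<close> unfolding uniformly_continuous_on_def dist_real_def by metis
  show ?thesis
  proof (intro exI[of _ "min d 1"] conjI ballI allI impI)
    fix x y assume x: "x \<in> U" and y: "\<bar>y - x\<bar> < min d 1"
    show "\<bar>f y - f x\<bar> < \<epsilon>"
      using M[OF x] y by (intro d(2)) auto
  qed (use d in auto)
qed

lemma continuous_on_funpow:
  fixes f :: "'a::topological_space \<Rightarrow> 'a"
  assumes "continuous_on UNIV f"
  shows "continuous_on UNIV (f ^^ i)"
proof (induction i)
  case (Suc i)
  show ?case
    using continuous_on_compose[OF Suc continuous_on_subset[OF assms subset_UNIV]] by (simp add: o_def)
qed (simp add: id_def)

text \<open>
  Any selection \<open>F i\<close> of indices \<open>b\<close> with \<open>p b\<close> near \<open>f (p i)\<close> is a model. The notion is therefore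
  monotone in \<open>\<delta>\<close>, so that one model can serve all exponents \<open>l\<close> at once.
\<close>

definition discrete_model :: "(real \<Rightarrow> real) \<Rightarrow> real set \<Rightarrow> real \<Rightarrow> nat \<Rightarrow>
    (nat \<Rightarrow> real) \<Rightarrow> (nat \<Rightarrow> nat set) \<Rightarrow> bool"
  where "discrete_model f U \<delta> n p F \<longleftrightarrow>
    mono_on {1..n} p \<and> p ` {1..n} \<subseteq> U \<and>
    (\<forall>i\<in>{1..n}. F i \<subseteq> {1..n} \<and> (\<forall>b\<in>F i. \<bar>f (p i) - p b\<bar> < \<delta>))"

lemma discrete_modelD:
  assumes "discrete_model f U \<delta> n p F"
  shows "mono_on {1..n} p" "\<And>i. i \<in> {1..n} \<Longrightarrow> p i \<in> U" "\<forall>i\<in>{1..n}. F i \<subseteq> {1..n}"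
    "\<And>i b. i \<in> {1..n} \<Longrightarrow> b \<in> F i \<Longrightarrow> \<bar>f (p i) - p b\<bar> < \<delta>"
  using assms unfolding discrete_model_def by auto

lemma discrete_model_mono:
  "discrete_model f U \<delta> n p F \<Longrightarrow> \<delta> \<le> \<delta>' \<Longrightarrow> discrete_model f U \<delta>' n p F"
  unfolding discrete_model_def by force

text \<open>
  An approximate intermediate value theorem: if neither \<open>u\<close> nor \<open>v\<close> already works, then \<open>y\<close> lies between
  \<open>g u\<close> and \<open>g v\<close>.
\<close>

lemma connected_image_near:
  fixes g :: "real \<Rightarrow> real"
  assumes "continuous_on UNIV g" "connected K" and uv: "u \<in> K" "v \<in> K"
    and "g u < y + \<epsilon>" "y - \<epsilon> < g v" "\<epsilon> > 0"
  shows "\<exists>w\<in>K. \<bar>g w - y\<bar> < \<epsilon>"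
proof -
  have conn: "connected (g ` K)"
    using assms by (blast intro: connected_continuous_image continuous_on_subset)
  consider "y - \<epsilon> < g u" | "g v < y + \<epsilon>" | "g u \<le> y" "y \<le> g v"
    using assms(5-7) by linarith
  then show ?thesis
  proof cases
    case 3
    then have "y \<in> g ` K"
      using connectedD_interval[OF conn, of "g u" "g v" y] uv by auto
    then show ?thesis
      using \<open>\<epsilon> > 0\<close> by force
  next
    case 1
    then show ?thesis
      using uv(1) assms(5) by (intro bexI[of _ u]) auto
  next
    case 2
    then show ?thesis
      using uv(2) assms(6) by (intro bexI[of _ v]) auto
  qed
qed

text \<open>
  The tolerances are chosen backwards, by induction on the number of steps: to be \<open>\<epsilon>\<close>-close after one
  more step, it suffices to be \<open>\<eta>\<close>-close before it, where \<open>f\<close> spreads \<open>\<eta>\<close>-close points by at most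
  \<open>\<epsilon> / 2\<close>; the other half of \<open>\<epsilon>\<close> absorbs the error of the model. This approximates the points of
  \<open>F a\<close> by values on \<open>K\<close>. The points that the convex hull adds lie between two such points, so
  connectedness of \<open>K\<close> supplies values near them as well.
\<close>

lemma discrete_hull_tracking:
  fixes f :: "real \<Rightarrow> real"
  assumes f: "continuous_on UNIV f" and U: "compact U" and "\<epsilon> > 0"
  shows "\<exists>\<delta>>0. \<forall>n p F K A b. discrete_model f U \<delta> n p F \<longrightarrow> connected K \<longrightarrow>
    A \<subseteq> {1..n} \<longrightarrow> p ` A \<subseteq> K \<longrightarrow> b \<in> (conv_image F ^^ i) A \<longrightarrow>
    (\<exists>u\<in>K. \<bar>(f ^^ i) u - p b\<bar> < \<epsilon>)"
  using \<open>\<epsilon> > 0\<close>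
proof (induction i arbitrary: \<epsilon>)
  case 0
  have "\<exists>u\<in>K. \<bar>(f ^^ 0) u - p b\<bar> < \<epsilon>"
    if "p ` A \<subseteq> K" "b \<in> (conv_image F ^^ 0) A" for p :: "nat \<Rightarrow> real" and A K F b
    using that 0 by (intro bexI[of _ "p b"]) auto
  then show ?case
    using zero_less_one by blast
next
  case (Suc i)
  obtain \<eta> where \<eta>: "\<eta> > 0" "\<And>x y. x \<in> U \<Longrightarrow> \<bar>y - x\<bar> < \<eta> \<Longrightarrow> \<bar>f y - f x\<bar> < \<epsilon> / 2"
    using uniform_continuity_near_compact[OF f U half_gt_zero[OF Suc.prems]] by blast
  obtain \<delta> where \<delta>: "\<delta> > 0" "\<And>n p F K A b. discrete_model f U \<delta> n p F \<Longrightarrow> connected K \<Longrightarrow>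
    A \<subseteq> {1..n} \<Longrightarrow> p ` A \<subseteq> K \<Longrightarrow> b \<in> (conv_image F ^^ i) A \<Longrightarrow>
    \<exists>u\<in>K. \<bar>(f ^^ i) u - p b\<bar> < \<eta>"
    using Suc.IH[OF \<eta>(1)] by metis
  show ?case
  proof (intro exI[of _ "min \<delta> (\<epsilon> / 2)"] conjI allI impI)
    show "min \<delta> (\<epsilon> / 2) > 0"
      using \<delta> Suc.prems by simp
    fix n p F K A b
    assume model: "discrete_model f U (min \<delta> (\<epsilon> / 2)) n p F" and K: "connected K"
      and A: "A \<subseteq> {1..n}" "p ` A \<subseteq> K" and b: "b \<in> (conv_image F ^^ Suc i) A"
    note model' = discrete_modelD[OF model]
    define A' where "A' = (conv_image F ^^ i) A"
    define B where "B = (\<Union>a\<in>A'. F a)"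
    have A': "A' \<subseteq> {1..n}"
      unfolding A'_def using conv_image_funpow_subset[OF model'(3) A(1)] .
    then have B: "B \<subseteq> {1..n}"
      unfolding B_def using model'(3) by blast
    then have "finite B"
      using finite_subset by blast
    have *: "\<exists>u\<in>K. \<bar>(f ^^ Suc i) u - p y\<bar> < \<epsilon>" if y: "y \<in> B" for y
    proof -
      obtain x where x: "x \<in> A'" "y \<in> F x"
        using y by (auto simp: B_def)
      then obtain u where u: "u \<in> K" "\<bar>(f ^^ i) u - p x\<bar> < \<eta>"
        using \<delta>(2)[OF discrete_model_mono[OF model] K A, of x] by (auto simp: A'_def)
      then have "\<bar>f ((f ^^ i) u) - f (p x)\<bar> < \<epsilon> / 2"
        using x A' model'(2) by (intro \<eta>(2)) auto
      moreover have "\<bar>f (p x) - p y\<bar> < \<epsilon> / 2"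
        using model'(4)[of x y] x A' by auto
      ultimately have "\<bar>(f ^^ Suc i) u - p y\<bar> < \<epsilon>"
        unfolding funpow.simps o_apply by linarith
      then show ?thesis
        using u by blast
    qed
    have "b \<in> conv_image F A'"
      using b by (simp add: A'_def)
    then have "B \<noteq> {}" and between: "Min B \<le> b" "b \<le> Max B"
      by (auto simp: conv_image_def Let_def B_def split: if_splits)
    then have in_B: "Min B \<in> B" "Max B \<in> B"
      using \<open>finite B\<close> by auto
    have "p (Min B) \<le> p b" "p b \<le> p (Max B)"
      using between in_B B by (force intro!: mono_onD[OF model'(1)])+
    moreover obtain u v where u: "u \<in> K" "\<bar>(f ^^ Suc i) u - p (Min B)\<bar> < \<epsilon>"
      and v: "v \<in> K" "\<bar>(f ^^ Suc i) v - p (Max B)\<bar> < \<epsilon>"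
      using *[OF in_B(1)] *[OF in_B(2)] by blast
    ultimately have "(f ^^ Suc i) u < p b + \<epsilon>" "p b - \<epsilon> < (f ^^ Suc i) v"
      by linarith+
    then show "\<exists>u\<in>K. \<bar>(f ^^ Suc i) u - p b\<bar> < \<epsilon>"
      by (rule connected_image_near[OF continuous_on_funpow[OF f] K u(1) v(1) _ _ Suc.prems])
  qed
qed

text \<open>
  If \<open>\<bar>f\<^sup>l x - x\<bar> \<ge> \<epsilon>\<close> on \<open>U\<close>, then a point \<open>u\<close> of the segment whose image under \<open>f\<^sup>l\<close> is less than \<open>\<epsilon>\<close> to the
  right of the left endpoint must be moved to the left, since it cannot be moved to the right by
  \<open>\<epsilon>\<close> or more. In the same way, a point whose image is near the right endpoint is moved to the right,
  and in between some point is fixed.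
\<close>

lemma no_periodic_point_imp_no_discrete_recurrence:
  fixes f :: "real \<Rightarrow> real"
  assumes f: "continuous_on UNIV f" and U: "compact U"
    and nofix: "\<And>x. x \<in> U \<Longrightarrow> (f ^^ l) x \<noteq> x"
  shows "\<exists>\<delta>>0. \<forall>n p F r s. discrete_model f U \<delta> n p F \<longrightarrow> r \<in> {1..n} \<longrightarrow> s \<in> {1..n} \<longrightarrow>
    closed_segment (p r) (p s) \<subseteq> U \<longrightarrow> \<not> {r, s} \<subseteq> (conv_image F ^^ l) {r, s}"
proof -
  let ?g = "\<lambda>x. (f ^^ l) x - x"
  have g: "continuous_on S ?g" for S
    using continuous_on_funpow[OF f] continuous_on_subset by (intro continuous_intros) blast
  obtain \<epsilon> where \<epsilon>: "\<epsilon> > 0" "\<And>x. x \<in> U \<Longrightarrow> \<epsilon> \<le> \<bar>?g x\<bar>"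
  proof (cases "U = {}")
    case False
    obtain x where "x \<in> U" "\<And>y. y \<in> U \<Longrightarrow> \<bar>?g x\<bar> \<le> \<bar>?g y\<bar>"
      using continuous_attains_inf[OF U False continuous_on_rabs[OF g]] by blast
    then show thesis
      using that[of "\<bar>?g x\<bar>"] nofix by auto
  qed (use that[of 1] in auto)
  obtain \<delta> where \<delta>: "\<delta> > 0" "\<And>n p F K A b. discrete_model f U \<delta> n p F \<Longrightarrow> connected K \<Longrightarrow>
    A \<subseteq> {1..n} \<Longrightarrow> p ` A \<subseteq> K \<Longrightarrow> b \<in> (conv_image F ^^ l) A \<Longrightarrow>
    \<exists>u\<in>K. \<bar>(f ^^ l) u - p b\<bar> < \<epsilon>"
    using discrete_hull_tracking[OF f U \<epsilon>(1), of l] by metis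
  have no_rec: False
    if model: "discrete_model f U \<delta> n p F" and rs: "r \<in> {1..n}" "s \<in> {1..n}" "p r \<le> p s"
      and seg: "closed_segment (p r) (p s) \<subseteq> U" and rec: "{r, s} \<subseteq> (conv_image F ^^ l) {r, s}"
    for n p F r s
  proof -
    let ?K = "closed_segment (p r) (p s)"
    have track: "\<exists>u\<in>?K. \<bar>(f ^^ l) u - p b\<bar> < \<epsilon>" if "b \<in> {r, s}" for b
      using rec rs that by (intro \<delta>(2)[OF model, of ?K "{r, s}"]) auto
    obtain u v where u: "u \<in> ?K" "\<bar>(f ^^ l) u - p r\<bar> < \<epsilon>"
      and v: "v \<in> ?K" "\<bar>(f ^^ l) v - p s\<bar> < \<epsilon>"
      using track[of r] track[of s] by blast
    have "p r \<le> u" "v \<le> p s"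
      using u v \<open>p r \<le> p s\<close> by (auto simp: closed_segment_eq_real_ivl)
    then have "?g u < \<epsilon>" "- \<epsilon> < ?g v"
      using u v by auto
    moreover have "\<epsilon> \<le> \<bar>?g u\<bar>" "\<epsilon> \<le> \<bar>?g v\<bar>"
      using u v seg \<epsilon> by blast+
    ultimately have "?g u \<le> 0" "0 \<le> ?g v"
      using \<epsilon>(1) by linarith+
    moreover have "connected (?g ` ?K)"
      by (intro connected_continuous_image g) simp
    ultimately have "0 \<in> ?g ` ?K"
      using connectedD_interval[of "?g ` ?K" "?g u" "?g v" 0] u v by blast
    then show False
      using seg nofix by auto
  qed
  show ?thesis
  proof (intro exI[of _ \<delta>] conjI allI impI notI)
    fix n p F r s
    assume "discrete_model f U \<delta> n p F" "r \<in> {1..n}" "s \<in> {1..n}"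
      "closed_segment (p r) (p s) \<subseteq> U" "{r, s} \<subseteq> (conv_image F ^^ l) {r, s}"
    then show False
      using no_rec[of n p F r s] no_rec[of n p F s r]
      by (cases "p r \<le> p s") (auto simp: closed_segment_commute insert_commute)
  qed (rule \<delta>(1))
qed

section \<open>Discretising a covering map\<close>

text \<open>
  Surjectivity of the model comes from the covering property: a net point \<open>p b\<close> is \<open>f x\<close> for some
  \<open>x \<in> U\<close>, and a net point \<open>p a\<close> close enough to \<open>x\<close> has an image within \<open>\<delta>\<close> of \<open>p b\<close>.
\<close>

lemma covering_discrete_model:
  fixes f :: "real \<Rightarrow> real"
  assumes f: "continuous_on UNIV f" and U: "compact U" "U \<noteq> {}" and cover: "U \<subseteq> f ` U" and "\<delta> > 0"
  shows "\<exists>n p F. n \<ge> 1 \<and> discrete_model f U \<delta> n p F \<and> (\<Union>i\<in>{1..n}. F i) = {1..n}"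
proof -
  obtain \<rho> where \<rho>: "\<rho> > 0" "\<And>x y. x \<in> U \<Longrightarrow> \<bar>y - x\<bar> < \<rho> \<Longrightarrow> \<bar>f y - f x\<bar> < \<delta>"
    using uniform_continuity_near_compact[OF f U(1) \<open>\<delta> > 0\<close>] by blast
  obtain S where S: "finite S" "S \<subseteq> U" "U \<subseteq> (\<Union>x\<in>S. ball x \<rho>)"
    using seq_compact_imp_totally_bounded
        [OF compact_imp_seq_compact[OF U(1)], THEN spec, THEN mp, OF \<rho>(1)] by blast
  define n where "n = card S"
  obtain h where h: "bij_betw h {..<n} S" "strict_mono_on {..<n} h"
    unfolding n_def by (rule finite_linorder_enumeration[OF S(1)])
  \<comment> \<open>The enumeration \<open>h\<close> starts at \<open>0\<close>, the indices of the model at \<open>1\<close>.\<close>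
  define p where "p i = h (i - 1)" for i
  define F where "F a = {b \<in> {1..n}. \<bar>f (p a) - p b\<bar> < \<delta>}" for a
  have p_image: "p ` {1..n} = S"
  proof -
    have "(\<lambda>i. i - 1) ` {1..n} = {..<n}"
      by (auto simp: image_iff intro!: bexI[of _ "Suc _"])
    then have "p ` {1..n} = h ` {..<n}"
      unfolding p_def by (metis image_image)
    then show ?thesis
      using h(1) by (simp add: bij_betw_def)
  qed
  show ?thesis
  proof (intro exI[of _ n] exI[of _ p] exI[of _ F] conjI)
    have "S \<noteq> {}"
      using S(3) U(2) by auto
    then show "n \<ge> 1"
      using S(1) by (simp add: n_def Suc_le_eq card_gt_0_iff)
    have "mono_on {1..n} p"
      using strict_mono_on_leD[OF h(2)] by (auto simp: p_def intro!: mono_onI)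
    then show "discrete_model f U \<delta> n p F"
      using p_image S(2) by (auto simp: discrete_model_def F_def)
    have "\<exists>a\<in>{1..n}. b \<in> F a" if b: "b \<in> {1..n}" for b
    proof -
      obtain x where x: "x \<in> U" "p b = f x"
        using b p_image S(2) cover by blast
      then obtain y where y: "y \<in> S" "\<bar>y - x\<bar> < \<rho>"
        using S(3) by (auto simp: dist_real_def)
      then obtain a where "a \<in> {1..n}" "p a = y"
        using p_image by blast
      then show ?thesis
        using \<rho>(2)[OF x(1) y(2)] x(2) b by (auto simp: F_def)
    qed
    then show "(\<Union>i\<in>{1..n}. F i) = {1..n}"
      by (auto simp: F_def)
  qed
qed

section \<open>Colouring a union of intervals\<close>

text \<open>
  The colour \<open>R x\<close> is the largest right endpoint of an interval containing \<open>x\<close>. For \<open>x \<le> y\<close>, the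
  interval that realises \<open>R x\<close> either contains \<open>y\<close>, whence \<open>R x \<le> R y\<close>, or ends before \<open>y\<close>, whence
  \<open>R x < y \<le> R y\<close>. If \<open>R x = R y\<close>, then the second case is impossible, so this interval contains
  both points.
\<close>

lemma union_intervals_colouring:
  fixes a b :: "nat \<Rightarrow> real" and k :: nat
  defines "U \<equiv> \<Union>j\<in>{1..k}. {a j..b j}"
  shows "\<exists>R :: real \<Rightarrow> real. mono_on U R \<and> R ` U \<subseteq> b ` {1..k} \<and>
    (\<forall>x\<in>U. \<forall>y\<in>U. R x = R y \<longrightarrow> closed_segment x y \<subseteq> U)"
proof -
  define E where "E x = b ` {j \<in> {1..k}. x \<in> {a j..b j}}" for x
  define R where "R x = Max (E x)" for x
  have fin: "finite (E x)" for x
    by (simp add: E_def)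
  have R_in: "\<exists>j\<in>{1..k}. a j \<le> x \<and> x \<le> b j \<and> R x = b j" if "x \<in> U" for x
  proof -
    have "E x \<noteq> {}"
      using that by (auto simp: U_def E_def)
    then have "R x \<in> E x"
      unfolding R_def by (rule Max_in[OF fin])
    then show ?thesis
      by (auto simp: E_def)
  qed
  have R_ge: "b j \<le> R x" if "j \<in> {1..k}" "a j \<le> x" "x \<le> b j" for j x
    unfolding R_def by (rule Max_ge[OF fin]) (use that in \<open>auto simp: E_def\<close>)
  have seg: "closed_segment x y \<subseteq> U" if xy: "x \<in> U" "y \<in> U" "R x = R y" "x \<le> y" for x y
  proof -
    obtain j where j: "j \<in> {1..k}" "a j \<le> x" "R x = b j"
      using R_in[OF xy(1)] by auto
    have "y \<le> R y"
      using R_in[OF xy(2)] by auto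
    then have "{x..y} \<subseteq> {a j..b j}"
      using j xy by auto
    then show ?thesis
      using j(1) xy(4) by (auto simp: U_def closed_segment_eq_real_ivl)
  qed
  show ?thesis
  proof (intro exI[of _ R] conjI ballI impI)
    show "mono_on U R"
    proof (rule mono_onI)
      fix x y assume xy: "x \<in> U" "y \<in> U" "x \<le> y"
      obtain j where j: "j \<in> {1..k}" "a j \<le> x" "R x = b j"
        using R_in[OF xy(1)] by auto
      have "y \<le> R y"
        using R_in[OF xy(2)] by auto
      then show "R x \<le> R y"
        using R_ge[of j y] j xy(3) by (cases "y \<le> b j") auto
    qed
    show "R ` U \<subseteq> b ` {1..k}"
      using R_in by force
    show "closed_segment x y \<subseteq> U" if "x \<in> U" "y \<in> U" "R x = R y" for x y
      using seg[of x y] seg[of y x] that by (cases "x \<le> y") (auto simp: closed_segment_commute)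
  qed
qed

section \<open>From (D) to periodic points\<close>

theorem theorem1p5:
  assumes "statement_D"
  shows "statement_P"
  unfolding statement_P_def
proof (intro allI impI)
  fix k :: nat and f :: "real \<Rightarrow> real" and a b :: "nat \<Rightarrow> real"
  assume "k \<ge> 1" and f: "continuous_on UNIV f" and ab: "\<forall>j\<in>{1..k}. a j \<le> b j"
    and cover: "f ` (\<Union>j\<in>{1..k}. {a j..b j}) \<supseteq> (\<Union>j\<in>{1..k}. {a j..b j})"
  define U where "U = (\<Union>j\<in>{1..k}. {a j..b j})"
  have U: "compact U" "U \<noteq> {}"
    using \<open>k \<ge> 1\<close> ab by (force simp: U_def intro!: compact_UN)+
  obtain R :: "real \<Rightarrow> real" where R: "mono_on U R" "R ` U \<subseteq> b ` {1..k}"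
    "\<And>x y. x \<in> U \<Longrightarrow> y \<in> U \<Longrightarrow> R x = R y \<Longrightarrow> closed_segment x y \<subseteq> U"
    using union_intervals_colouring[of a b k, folded U_def] by blast
  show "\<exists>x0\<in>\<Union>j\<in>{1..k}. {a j..b j}. \<exists>l\<in>{1..k}. (f ^^ l) x0 = x0"
  proof (rule ccontr)
    assume "\<not> ?thesis"
    then have "\<And>l x. l \<in> {1..k} \<Longrightarrow> x \<in> U \<Longrightarrow> (f ^^ l) x \<noteq> x"
      unfolding U_def by blast
    then have "\<forall>l\<in>{1..k}. \<exists>\<delta>>0. \<forall>n p F r s. discrete_model f U \<delta> n p F \<longrightarrow>
      r \<in> {1..n} \<longrightarrow> s \<in> {1..n} \<longrightarrow> closed_segment (p r) (p s) \<subseteq> U \<longrightarrow>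
      \<not> {r, s} \<subseteq> (conv_image F ^^ l) {r, s}"
      by (intro ballI no_periodic_point_imp_no_discrete_recurrence f U(1)) auto
    from bchoice[OF this] obtain d where d: "\<forall>l\<in>{1..k}. d l > (0::real) \<and>
      (\<forall>n p F r s. discrete_model f U (d l) n p F \<longrightarrow>
        r \<in> {1..n} \<longrightarrow> s \<in> {1..n} \<longrightarrow> closed_segment (p r) (p s) \<subseteq> U \<longrightarrow>
        \<not> {r, s} \<subseteq> (conv_image F ^^ l) {r, s})"
      by (rule exE)
    define \<delta> where "\<delta> = Min (d ` {1..k})"
    have "\<forall>l\<in>{1..k}. d l > 0"
      using d by blast
    then have "\<delta> > 0"
      using \<open>k \<ge> 1\<close> by (simp add: \<delta>_def)
    from covering_discrete_model[OF f U cover[folded U_def] this]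
    obtain n p F where n: "n \<ge> 1" and model: "discrete_model f U \<delta> n p F"
      and onto: "(\<Union>i\<in>{1..n}. F i) = {1..n}"
      by blast
    note model' = discrete_modelD[OF model]
    have "mono_on {1..n} (R \<circ> p)"
      using model'(1,2) R(1) by (auto simp: monotone_on_def)
    moreover have "card ((R \<circ> p) ` {1..n}) \<le> k"
    proof -
      have "(R \<circ> p) ` {1..n} \<subseteq> b ` {1..k}"
        using model'(2) R(2) by auto
      then have "card ((R \<circ> p) ` {1..n}) \<le> card (b ` {1..k})"
        by (intro card_mono) auto
      also have "\<dots> \<le> k"
        using card_image_le[of "{1..k}" b] by simp
      finally show ?thesis .
    qed
    ultimately obtain r s l where rs: "r \<in> {1..n}" "s \<in> {1..n}" "R (p r) = R (p s)"
      and l: "l \<in> {1..k}" and rec: "{r, s} \<subseteq> (conv_image F ^^ l) {r, s}"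
      using statement_D_monotone_colouring[OF assms n model'(3) onto, of "R \<circ> p" k]
      unfolding o_apply by blast
    have "\<delta> \<le> d l"
      using l by (simp add: \<delta>_def)
    then have "discrete_model f U (d l) n p F"
      by (rule discrete_model_mono[OF model])
    moreover have "closed_segment (p r) (p s) \<subseteq> U"
      using rs model'(2) by (intro R(3)) auto
    ultimately show False
      using d l rs(1,2) rec by blast
  qed
qed

end
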